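(* The sparsification number is invariant under coarse equivalence: if $X$ and $Y$ are coarse equivalent metric spaces, then $a(X)=a(Y)$.
   Context: Metric Sparsification Property: a metric space $X$ has MS($c$), $0<c\le 1$, if there is a non-decreasing function $f:\mathbf{N}\to\mathbf{N}$ such that for all $m\in\mathbf{N}$ and every finite positive Borel measure $\mu$ on $X$ there is a Borel subset $\Omega=\bigsqcup_{i\in I}\Omega_i$ of $X$ with (i) $d(\Omega_i,\Omega_j)\ge m$ for all $i\ne j$ in $I$, where $d(A,B)=\inf\{d(a,b):a\in A,b\in B\}$; (ii) $\mathrm{Diam}(\Omega_i)\le f(m)$ for all $i\in I$; (iii) $\mu(\Omega)\ge c\,\mu(X)$. The sparsification number $a(X)$ is the supremum of all $c$ such that $X$ has MS($c$) (and $a(X)=0$ if there is no such $c$). Coarse equivalence: a Borel map $F:X\to Y$ of metric spaces is coarse if (1) for every $r>0$ there is $R>0$ such that $d(F(x),F(y))<R$ whenever $d(x,y)<r$; (2) $F^{-1}(B)$ is bounded for every bounded $B\subseteq Y$. $X$ is coarse equivalent to $Y$ if there are coarse maps $F:X\to Y$, $G:Y\to X$ and a constant $C$ with $d(G(F(x)),x)<C$ for all $x\in X$ and $d(F(G(y)),y)<C$ for all $y\in Y$. *)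

theory Defs
  imports "HOL-Analysis.Analysis"
begin

text \<open>A metric space is a type of class \<^class>\<open>metric_space\<close>; notions that depend only on the
  space take the type itself as argument.\<close>

text \<open>The value is extended, so that the infimum over an empty set is \<open>\<infinity>\<close>; the library's real-valued
  \<^const>\<open>setdist\<close> is \<open>0\<close> when one of the sets is empty.\<close>

definition set_distance :: "'a::metric_space set \<Rightarrow> 'a set \<Rightarrow> ennreal" where
  "set_distance A B = (INF (a, b)\<in>A \<times> B. ennreal (dist a b))"

text \<open>The disjoint family of pieces is given as a set \<open>P\<close> of sets with union \<open>\<Omega>\<close>. A disjoint indexed family
  can only repeat the empty set, and dropping such repetitions affects none of the conditions.
  Boundedness is required because the real-valued \<^const>\<open>diameter\<close> is only meaningful for
  bounded sets.\<close>

definition metric_sparsification :: "'a::metric_space itself \<Rightarrow> real \<Rightarrow> bool" where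
  "metric_sparsification _ c \<longleftrightarrow>
     0 < c \<and> c \<le> 1 \<and>
     (\<exists>f :: nat \<Rightarrow> nat. mono f \<and>
       (\<forall>m :: nat. \<forall>\<mu> :: 'a measure. finite_measure \<mu> \<and> sets \<mu> = sets borel \<longrightarrow>
         (\<exists>(\<Omega> :: 'a set) (P :: 'a set set).
            \<Omega> \<in> sets borel \<and> disjoint P \<and> \<Omega> = \<Union>P \<and>
            (\<forall>A\<in>P. \<forall>B\<in>P. A \<noteq> B \<longrightarrow> set_distance A B \<ge> of_nat m) \<and>
            (\<forall>A\<in>P. bounded A \<and> diameter A \<le> real (f m)) \<and>
            measure \<mu> \<Omega> \<ge> c * measure \<mu> (space \<mu>))))"

definition sparsification_number :: "'a::metric_space itself \<Rightarrow> real" where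
  "sparsification_number X =
     (if \<exists>c. metric_sparsification X c then Sup {c. metric_sparsification X c} else 0)"

definition coarse_map :: "('a::metric_space \<Rightarrow> 'b::metric_space) \<Rightarrow> bool" where
  "coarse_map F \<longleftrightarrow>
     F \<in> borel_measurable borel \<and>
     (\<forall>r>0. \<exists>R>0. \<forall>x y. dist x y < r \<longrightarrow> dist (F x) (F y) < R) \<and>
     (\<forall>B. bounded B \<longrightarrow> bounded (F -` B))"

definition coarse_equivalent :: "'a::metric_space itself \<Rightarrow> 'b::metric_space itself \<Rightarrow> bool" where
  "coarse_equivalent _ _ \<longleftrightarrow>
     (\<exists>(F :: 'a \<Rightarrow> 'b) (G :: 'b \<Rightarrow> 'a) (C :: real).
        coarse_map F \<and> coarse_map G \<and>
        (\<forall>x. dist (G (F x)) x < C) \<and> (\<forall>y. dist (F (G y)) y < C))"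

end

theory Submission imports Defs begin

text \<open>Push a measure \<open>\<mu>\<close> on \<open>X\<close> forward along \<open>F : X \<rightarrow> Y\<close>, sparsify it in \<open>Y\<close> at a scale
  so large that \<open>F\<close> maps points at distance less than \<open>m\<close> to points closer than that scale, and
  pull the pieces back along \<open>F\<close>. The preimages carry the same mass and are \<open>m\<close>-separated, and
  they are uniformly bounded because \<open>G\<close> is coarse and \<open>G \<circ> F\<close> is close to the identity. Hence
  \<open>X\<close> and \<open>Y\<close> have MS(\<open>c\<close>) for exactly the same \<open>c\<close>.\<close>

lemma of_nat_le_set_distance_iff:
  "of_nat m \<le> set_distance A B \<longleftrightarrow> (\<forall>a\<in>A. \<forall>b\<in>B. real m \<le> dist a b)"
  unfolding set_distance_def ennreal_of_nat_eq_real_of_nat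
  by (auto simp: le_INF_iff)

text \<open>The constant \<open>c\<close> survives unchanged because pushing forward preserves mass;
  only the diameter bound \<open>f\<close> has to be replaced. The roles of \<open>F\<close> and
  \<open>G\<close> can be exchanged to get the converse.\<close>

lemma metric_sparsification_pullback:
  fixes F :: "'a::metric_space \<Rightarrow> 'b::metric_space" and G :: "'b \<Rightarrow> 'a"
  assumes F: "coarse_map F" and G: "coarse_map G"
    and GF: "\<And>x. dist (G (F x)) x < C"
    and MS: "metric_sparsification TYPE('b) c"
  shows "metric_sparsification TYPE('a) c"
proof -
  have F_meas: "F \<in> borel_measurable borel"
    using F by (simp add: coarse_map_def)
  obtain f :: "nat \<Rightarrow> nat" where f: "\<And>m (\<nu> :: 'b measure). finite_measure \<nu> \<Longrightarrow> sets \<nu> = sets borel \<Longrightarrow>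
       \<exists>\<Omega> P. \<Omega> \<in> sets borel \<and> disjoint P \<and> \<Omega> = \<Union>P \<and>
            (\<forall>A\<in>P. \<forall>B\<in>P. A \<noteq> B \<longrightarrow> set_distance A B \<ge> of_nat m) \<and>
            (\<forall>A\<in>P. bounded A \<and> diameter A \<le> real (f m)) \<and>
            measure \<nu> \<Omega> \<ge> c * measure \<nu> (space \<nu>)"
    and c: "0 < c" "c \<le> 1"
    using MS unfolding metric_sparsification_def by metis
  have "\<exists>M::nat. \<forall>x y. dist x y < real m \<longrightarrow> dist (F x) (F y) < real M" for m :: nat
  proof -
    \<comment> \<open>Coarseness is stated for positive radii only, so the shift by one covers
      \<open>m = 0\<close>.\<close>
    have "0 < real m + 1" by simp
    then obtain R where R: "\<And>x y. dist x y < real m + 1 \<Longrightarrow> dist (F x) (F y) < R"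
      using F unfolding coarse_map_def by blast
    obtain M :: nat where "R \<le> real M"
      using real_arch_simple by blast
    then show ?thesis
      using R by (intro exI[of _ M]) (smt (verit))
  qed
  then obtain scale :: "nat \<Rightarrow> nat"
    where scale: "\<And>m x y. dist x y < real m \<Longrightarrow> dist (F x) (F y) < real (scale m)"
    by metis
  have "\<exists>D::nat. \<forall>x y. dist (F x) (F y) \<le> real k \<longrightarrow> dist x y \<le> real D" for k :: nat
  proof -
    \<comment> \<open>Here the shift also turns the non-strict bound \<open>k\<close> into a strict
      one.\<close>
    have "0 < real k + 1" by simp
    then obtain R where R: "\<And>u v. dist u v < real k + 1 \<Longrightarrow> dist (G u) (G v) < R"
      using G unfolding coarse_map_def by blast
    \<comment> \<open>\<open>D\<close> bounds the path from \<open>x\<close> through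
      \<open>G (F x)\<close> and \<open>G (F y)\<close> to \<open>y\<close>.\<close>
    obtain D :: nat where D: "R + 2 * C \<le> real D"
      using real_arch_simple by blast
    have "dist x y \<le> real D" if "dist (F x) (F y) \<le> real k" for x y
    proof -
      have "dist x y \<le> dist (G (F x)) x + dist (G (F x)) (G (F y)) + dist (G (F y)) y"
        by metric
      moreover have "dist (G (F x)) (G (F y)) < R"
        using that by (intro R) simp
      ultimately show ?thesis
        using D GF[of x] GF[of y] by linarith
    qed
    then show ?thesis by blast
  qed
  then obtain width :: "nat \<Rightarrow> nat"
    where width: "\<And>k x y. dist (F x) (F y) \<le> real k \<Longrightarrow> dist x y \<le> real (width k)"
    by metis
  \<comment> \<open>\<open>scale\<close> and \<open>width\<close> come from choice and need not be
    monotone; the partial sums are, and they dominate their last term.\<close>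
  define g where "g m = (\<Sum>i\<le>m. width (f (scale i)))" for m
  have "mono g"
    unfolding g_def by (intro monoI sum_mono2) auto
  have width_le_g: "width (f (scale m)) \<le> g m" for m
    unfolding g_def by (rule member_le_sum) auto
  have "\<exists>\<Omega> P. \<Omega> \<in> sets borel \<and> disjoint P \<and> \<Omega> = \<Union>P \<and>
            (\<forall>A\<in>P. \<forall>B\<in>P. A \<noteq> B \<longrightarrow> set_distance A B \<ge> of_nat m) \<and>
            (\<forall>A\<in>P. bounded A \<and> diameter A \<le> real (g m)) \<and>
            measure \<mu> \<Omega> \<ge> c * measure \<mu> (space \<mu>)"
    if "finite_measure \<mu>" and sets_\<mu>: "sets \<mu> = sets borel" for m and \<mu> :: "'a measure"
  proof -
    interpret finite_measure \<mu> by fact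
    have F_\<mu>: "F \<in> borel_measurable \<mu>"
      using F_meas measurable_cong_sets[OF sets_\<mu> refl] by blast
    have space_\<mu>: "space \<mu> = UNIV"
      using sets_eq_imp_space_eq[OF sets_\<mu>] by simp
    obtain \<Omega> P where \<Omega>: "\<Omega> \<in> sets borel" and disj: "disjoint P" and \<Omega>_eq: "\<Omega> = \<Union>P"
      and sep: "\<And>A B. A \<in> P \<Longrightarrow> B \<in> P \<Longrightarrow> A \<noteq> B \<Longrightarrow> set_distance A B \<ge> of_nat (scale m)"
      and diam: "\<And>A. A \<in> P \<Longrightarrow> bounded A \<and> diameter A \<le> real (f (scale m))"
      and mass: "measure (distr \<mu> borel F) \<Omega> \<ge> c * measure (distr \<mu> borel F) (space (distr \<mu> borel F))"
      using f[OF finite_measure_distr[OF F_\<mu>], of "scale m"] by auto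
    \<comment> \<open>This pairwise bound yields both boundedness and the diameter estimate for the
      preimages.\<close>
    have dist_le: "dist x y \<le> real (g m)" if "A \<in> P" "F x \<in> A" "F y \<in> A" for A x y
    proof -
      have "dist (F x) (F y) \<le> real (f (scale m))"
        using diam[OF \<open>A \<in> P\<close>] diameter_bounded_bound[of A "F x" "F y"] that by auto
      then show ?thesis
        using width width_le_g[of m] by (meson of_nat_mono order_trans)
    qed
    show ?thesis
    proof (intro exI conjI ballI impI)
      show "F -` \<Omega> \<in> sets borel"
        using measurable_sets[OF F_meas \<Omega>] by simp
      show "disjoint ((-`) F ` P)"
        using disj unfolding disjoint_def by blast
      show "F -` \<Omega> = \<Union>((-`) F ` P)"
        using \<Omega>_eq by auto
      show "of_nat m \<le> set_distance A B"
        if A: "A \<in> (-`) F ` P" and B: "B \<in> (-`) F ` P" and "A \<noteq> B" for A B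
      proof -
        obtain A' B' where A': "A' \<in> P" "A = F -` A'" and B': "B' \<in> P" "B = F -` B'"
          using A B by blast
        \<comment> \<open>Distinct preimages come from distinct pieces, so the separation in the
          target applies; the contrapositive of \<open>scale\<close> then carries it back.\<close>
        have "real (scale m) \<le> dist (F x) (F y)" if "x \<in> A" "y \<in> B" for x y
          using sep[OF A'(1) B'(1)] \<open>A \<noteq> B\<close> A' B' that
          by (auto simp: of_nat_le_set_distance_iff)
        then show ?thesis
          unfolding of_nat_le_set_distance_iff using scale by (meson not_le)
      qed
      show "bounded A" if "A \<in> (-`) F ` P" for A
        using that dist_le unfolding bounded_two_points by blast
      show "diameter A \<le> real (g m)" if "A \<in> (-`) F ` P" for A
      \<comment> \<open>A piece that misses the range of \<open>F\<close> has empty preimage; its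
        diameter is \<open>0\<close> by convention, not a supremum.\<close>
      proof (cases "A = {}")
        case False
        have "dist x y \<le> real (g m)" if "x \<in> A" "y \<in> A" for x y
          using \<open>A \<in> (-`) F ` P\<close> that dist_le by blast
        with False show ?thesis
          by (auto simp: diameter_def intro!: cSUP_least)
      qed simp
      show "c * measure \<mu> (space \<mu>) \<le> measure \<mu> (F -` \<Omega>)"
        using mass \<Omega> F_\<mu> by (simp add: measure_distr space_\<mu>)
    qed
  qed
  then show ?thesis
    unfolding metric_sparsification_def using c \<open>mono g\<close> by blast
qed

theorem corollary3p4:
  assumes "coarse_equivalent TYPE('a::metric_space) TYPE('b::metric_space)"
  shows "sparsification_number TYPE('a) = sparsification_number TYPE('b)"
proof -
  obtain F :: "'a \<Rightarrow> 'b" and G :: "'b \<Rightarrow> 'a" and C where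
    "coarse_map F" "coarse_map G" "\<And>x. dist (G (F x)) x < C" "\<And>y. dist (F (G y)) y < C"
    using assms unfolding coarse_equivalent_def by blast
  then have "metric_sparsification TYPE('a) c \<longleftrightarrow> metric_sparsification TYPE('b) c" for c
    using metric_sparsification_pullback[of F G C] metric_sparsification_pullback[of G F C] by blast
  \<comment> \<open>The admissible constants coincide, hence so do their suprema and the default
    case \<open>0\<close>.\<close>
  then show ?thesis
    unfolding sparsification_number_def by presburger
qed

end
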